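(* Suppose that for each $i=1,\dots,m$ the set $X_i\subseteq\mathbb{R}^n$ is convex and closed and $f_i:\mathbb{R}^n\to\mathbb{R}$ is a convex function, and that the set $D^*=D^*_L$ is nonempty. Suppose that $F^*\cap F_L\neq\varnothing$. Let $\{w^k\}$, $w^k=(x^k,y^k)$, be generated by Method (PDMI) with arc index sets $I_k\subseteq L$ and stepsizes $\lambda_k$ such that, for some $\tau\in(0,1)$, $$\lambda_k\in\left[\tau,\ \frac{\sqrt{1-\tau}}{\sqrt{2}\,\|A_{(k)}\|}\right]\quad\text{for all } k\ge 1.$$ Then: (i) the sequence $\{w^k\}$ has limit points; (ii) if each $I_k$ is a basic index set, all the limit points of $\{w^k\}$ belong to $W^*$; (iii) if there exists a nonempty basic index set $I\subseteq L$ such that $I\subseteq I_k$ for all $k\ge1$ and $I=I_{k_s}$ for some infinite subsequence $\{w^{k_s}\}$, then the sequence $\{w^k\}$ converges to a point of $W^*$.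
   Context: Let $m,n$ be positive integers, $m\ge2$. For vertices (agents) $1,\dots,m$, fix for each unordered pair of distinct vertices one orientation, giving one oriented arc $i=(s,t)$; the $l=m(m-1)/2$ arcs are indexed by $L=\{1,\dots,l\}$. For $I\subseteq L$ and a vertex $j$, $\mathcal{N}^+_I(j)$ and $\mathcal{N}^-_I(j)$ are the sets of arcs in $I$ incoming to and outgoing from $j$, respectively (so $i=(s,t)\in I$ lies in $\mathcal{N}^-_I(s)$ and $\mathcal{N}^+_I(t)$). Write $x=(x_1,\dots,x_m)\in\mathbb{R}^{mn}$ with $x_j\in\mathbb{R}^n$; $f(x)=\sum_{j=1}^m f_j(x_j)$; $X=X_1\times\dots\times X_m$. For an arc $i=(s,t)$, $A_i$ is the $n\times mn$ matrix with $A_ix=x_s-x_t$. For $I\subseteq L$, $A_I$ is the matrix of stacked blocks $A_i$, $i\in I$; $A=A_L$; $F_I=\{x\in\mathbb{R}^{mn}: A_Ix=\mathbf{0}\}=\{x: x_s=x_t \ \forall\, i=(s,t)\in I\}$. $D^*_I$ is the solution set of $\min\{f(x): x\in X\cap F_I\}$, and $F^*$ is the solution set of $\min\{f(x): x\in X\}$. An index set $I\subseteq L$ is basic if, for every $x\in\mathbb{R}^{mn}$, $A_Ix=\mathbf{0}$ implies $A_Lx=\mathbf{0}$. Lagrange function: $\mathcal{L}(x,y)=f(x)+\langle y,Ax\rangle$ for $x\in\mathbb{R}^{mn}$, $y=(y_i)_{i\in L}\in\mathbb{R}^{ln}$, $y_i\in\mathbb{R}^n$. $W^*$ is the set of saddle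 points, i.e. of pairs $(x^*,y^* )\in X\times\mathbb{R}^{ln}$ with $\mathcal{L}(x^*,y)\le\mathcal{L}(x^*,y^* )\le\mathcal{L}(x,y^* )$ for all $y\in\mathbb{R}^{ln}$, $x\in X$. Method (PDMI): choose $I_0\subseteq L$, $x^0\in X$, and $y^0\in\mathbb{R}^{ln}$ with $y^0_i=\mathbf{0}$ for $i\notin I_0$. For $k=1,2,\dots$ choose $I_k\subseteq L$ and $\lambda_k>0$, set $y^k_i=\mathbf{0}$ for $i\notin I_k$, and then: Step 1: $p^k_i=y^{k-1}_i+\lambda_k(x^{k-1}_s-x^{k-1}_t)$ for every arc $i=(s,t)\in I_k$. Step 2: for each agent $s$, $v^k_s=\sum_{i\in\mathcal{N}^-_{I_k}(s)}p^k_i-\sum_{i\in\mathcal{N}^+_{I_k}(s)}p^k_i$ and $x^k_s=\operatorname{argmin}\{f_s(x_s)+\langle v^k_s,x_s\rangle+0.5\lambda_k^{-1}\|x_s-x^{k-1}_s\|^2 : x_s\in X_s\}$. Step 3: $y^k_i=y^{k-1}_i+\lambda_k(x^k_s-x^k_t)$ for every arc $i=(s,t)\in I_k$. Here $A_{(k)}=A_{I_k}$; $\|\cdot\|$ is the Euclidean norm for vectors and the induced operator norm for matrices; if $\|A_{(k)}\|=0$ the upper bound on $\lambda_k$ is read as $+\infty$ (with $\lambda_k$ finite). A limit point of a sequence is the limit of some convergent subsequence. *)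

theory Defs
  imports "HOL-Analysis.Analysis"
begin

text \<open>
  Vertices (agents) are the elements of a finite type \<open>'m\<close>, arc indices those of a finite type
  \<open>'l\<close>, so that the full index set \<open>L\<close> is \<open>UNIV\<close>. Primal vectors \<open>x = (x_1, ..., x_m)\<close> have type
  \<open>real^'n^'m\<close> and dual vectors \<open>y = (y_i)\<close>, \<open>i\<close> in \<open>L\<close>, have type \<open>real^'n^'l\<close>; the library norm
  and inner product on these types are the Euclidean ones of \<open>R^(mn)\<close> and \<open>R^(ln)\<close>.
  The arc with index \<open>i\<close> is the pair \<open>ends i = (s, t)\<close>, directed from \<open>s\<close> to \<open>t\<close>.
\<close>

text \<open>
  Exactly one orientation of each unordered pair of distinct vertices is indexed, and it is
  indexed once; in particular \<open>CARD('l) = m * (m - 1) / 2\<close>.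
\<close>

definition complete_orientation :: "('l::finite \<Rightarrow> 'm::finite \<times> 'm) \<Rightarrow> bool" where
  "complete_orientation ends \<longleftrightarrow>
     bij_betw (\<lambda>i. {fst (ends i), snd (ends i)}) UNIV {e. card e = 2}"

definition arcs_in :: "('l::finite \<Rightarrow> 'm::finite \<times> 'm) \<Rightarrow> 'l set \<Rightarrow> 'm \<Rightarrow> 'l set" where
  "arcs_in ends I j = {i \<in> I. snd (ends i) = j}"

definition arcs_out :: "('l::finite \<Rightarrow> 'm::finite \<times> 'm) \<Rightarrow> 'l set \<Rightarrow> 'm \<Rightarrow> 'l set" where
  "arcs_out ends I j = {i \<in> I. fst (ends i) = j}"

definition arc_diff :: "('l::finite \<Rightarrow> 'm::finite \<times> 'm) \<Rightarrow> 'l \<Rightarrow> real^'n^'m \<Rightarrow> real^'n" where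
  "arc_diff ends i x = x $ fst (ends i) - x $ snd (ends i)"

text \<open>
  The matrix \<open>A_I\<close> is represented by the linear map it induces. To keep one codomain for all \<open>I\<close>,
  the rows of blocks outside \<open>I\<close> are present but zero; this changes neither the kernel nor the
  operator norm (\<open>onorm\<close>).
\<close>

definition stacked_map ::
  "('l::finite \<Rightarrow> 'm::finite \<times> 'm) \<Rightarrow> 'l set \<Rightarrow> real^'n^'m \<Rightarrow> real^'n^'l" where
  "stacked_map ends I x = (\<chi> i. if i \<in> I then arc_diff ends i x else 0)"

definition consensus_set :: "('l::finite \<Rightarrow> 'm::finite \<times> 'm) \<Rightarrow> 'l set \<Rightarrow> (real^'n^'m) set" where
  "consensus_set ends I = {x. stacked_map ends I x = 0}"

text \<open>The dimension \<open>n\<close> is passed as a type argument, since it occurs only in the bound variable.\<close>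

definition basic_index_set ::
  "'n::finite itself \<Rightarrow> ('l::finite \<Rightarrow> 'm::finite \<times> 'm) \<Rightarrow> 'l set \<Rightarrow> bool" where
  "basic_index_set _ ends I \<longleftrightarrow>
     (\<forall>x :: real^'n^'m. stacked_map ends I x = 0 \<longrightarrow> stacked_map ends UNIV x = 0)"

definition total_cost :: "('m::finite \<Rightarrow> real^'n \<Rightarrow> real) \<Rightarrow> real^'n^'m \<Rightarrow> real" where
  "total_cost f x = (\<Sum>j\<in>UNIV. f j (x $ j))"

definition product_set :: "('m::finite \<Rightarrow> (real^'n) set) \<Rightarrow> (real^'n^'m) set" where
  "product_set X = {x. \<forall>j. x $ j \<in> X j}"

definition solution_set :: "('a \<Rightarrow> real) \<Rightarrow> 'a set \<Rightarrow> 'a set" where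
  "solution_set g S = {x. is_arg_min g (\<lambda>z. z \<in> S) x}"

definition D_star ::
  "('m::finite \<Rightarrow> real^'n \<Rightarrow> real) \<Rightarrow> ('m \<Rightarrow> (real^'n) set) \<Rightarrow>
   ('l::finite \<Rightarrow> 'm \<times> 'm) \<Rightarrow> 'l set \<Rightarrow> (real^'n^'m) set" where
  "D_star f X ends I = solution_set (total_cost f) (product_set X \<inter> consensus_set ends I)"

definition F_star ::
  "('m::finite \<Rightarrow> real^'n \<Rightarrow> real) \<Rightarrow> ('m \<Rightarrow> (real^'n) set) \<Rightarrow> (real^'n^'m) set" where
  "F_star f X = solution_set (total_cost f) (product_set X)"

definition lagrangian ::
  "('m::finite \<Rightarrow> real^'n \<Rightarrow> real) \<Rightarrow> ('l::finite \<Rightarrow> 'm \<times> 'm) \<Rightarrow>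
   real^'n^'m \<Rightarrow> real^'n^'l \<Rightarrow> real" where
  "lagrangian f ends x y = total_cost f x + y \<bullet> stacked_map ends UNIV x"

definition saddle_points ::
  "('m::finite \<Rightarrow> real^'n \<Rightarrow> real) \<Rightarrow> ('m \<Rightarrow> (real^'n) set) \<Rightarrow>
   ('l::finite \<Rightarrow> 'm \<times> 'm) \<Rightarrow> ((real^'n^'m) \<times> (real^'n^'l)) set" where
  "saddle_points f X ends =
     {(xs, ys). xs \<in> product_set X \<and>
        (\<forall>y. lagrangian f ends xs y \<le> lagrangian f ends xs ys) \<and>
        (\<forall>x \<in> product_set X. lagrangian f ends xs ys \<le> lagrangian f ends x ys)}"

text \<open>
  In \<open>pdmi_p\<close> and \<open>pdmi_v\<close>, the arguments \<open>x\<close>, \<open>y\<close> are the previous iterate and \<open>lam\<close>, \<open>I\<close> the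
  current stepsize and index set.
\<close>

definition pdmi_p ::
  "('l::finite \<Rightarrow> 'm::finite \<times> 'm) \<Rightarrow> real \<Rightarrow> real^'n^'m \<Rightarrow> real^'n^'l \<Rightarrow> 'l \<Rightarrow> real^'n" where
  "pdmi_p ends lam x y i = y $ i + lam *\<^sub>R (x $ fst (ends i) - x $ snd (ends i))"

definition pdmi_v ::
  "('l::finite \<Rightarrow> 'm::finite \<times> 'm) \<Rightarrow> 'l set \<Rightarrow> real \<Rightarrow> real^'n^'m \<Rightarrow> real^'n^'l \<Rightarrow>
   'm \<Rightarrow> real^'n" where
  "pdmi_v ends I lam x y s =
     (\<Sum>i\<in>arcs_out ends I s. pdmi_p ends lam x y i) - (\<Sum>i\<in>arcs_in ends I s. pdmi_p ends lam x y i)"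

definition pdmi_sequence ::
  "('m::finite \<Rightarrow> real^'n \<Rightarrow> real) \<Rightarrow> ('m \<Rightarrow> (real^'n) set) \<Rightarrow> ('l::finite \<Rightarrow> 'm \<times> 'm) \<Rightarrow>
   (nat \<Rightarrow> 'l set) \<Rightarrow> (nat \<Rightarrow> real) \<Rightarrow> (nat \<Rightarrow> real^'n^'m) \<Rightarrow> (nat \<Rightarrow> real^'n^'l) \<Rightarrow> bool" where
  "pdmi_sequence f X ends Is lam x y \<longleftrightarrow>
     x 0 \<in> product_set X \<and>
     (\<forall>i. i \<notin> Is 0 \<longrightarrow> y 0 $ i = 0) \<and>
     (\<forall>k\<ge>1.
        lam k > 0 \<and>
        (\<forall>i. i \<notin> Is k \<longrightarrow> y k $ i = 0) \<and>
        (\<forall>s. is_arg_min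
               (\<lambda>u. f s u + pdmi_v ends (Is k) (lam k) (x (k - 1)) (y (k - 1)) s \<bullet> u
                     + 0.5 * inverse (lam k) * (norm (u - x (k - 1) $ s))\<^sup>2)
               (\<lambda>u. u \<in> X s)
               (x k $ s)) \<and>
        (\<forall>i \<in> Is k. y k $ i =
               y (k - 1) $ i + lam k *\<^sub>R (x k $ fst (ends i) - x k $ snd (ends i))))"

definition seq_limit_point :: "(nat \<Rightarrow> 'a::topological_space) \<Rightarrow> 'a \<Rightarrow> bool" where
  "seq_limit_point w z \<longleftrightarrow> (\<exists>r. strict_mono r \<and> (w \<circ> r) \<longlonglongrightarrow> z)"

end

theory Submission
  imports Defs
begin

text \<open>
  The argument is one of Fejer monotonicity. The hypothesis that some minimiser \<open>x\<^sup>*\<close> of the total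
  cost over the whole of \<open>X\<close> lies in the consensus subspace means exactly that \<open>(x\<^sup>*, 0)\<close> is a
  saddle point: no multiplier is needed to enforce consensus.

  One step of the method is a prediction-correction step for the Lagrangian restricted to the active
  arcs. Testing the optimality condition of the primal update against a saddle point
  \<open>(x\<^sup>*, \<eta>)\<close>, and adding the identity that expands \<open>|y^k - \<eta>|\<^sup>2\<close>, gives
    \<open>|w^k - w\<^sup>*|\<^sup>2 + c |w^k - w^(k-1)|\<^sup>2 \<le> |w^(k-1) - w\<^sup>*|\<^sup>2\<close>
  with a constant \<open>c > 0\<close>, because the only term of indefinite sign is a cross term of size
  \<open>2 \<lambda> |A_I| |x^k - x^(k-1)| |y^k - y^(k-1)|\<close>, which the stepsize bound absorbs
  (lemma \<open>pdmi_step_Fejer\<close>). The estimate needs \<open>\<eta>\<close> to vanish off the active arcs: erasing the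
  inactive components of \<open>y\<close> is then an orthogonal projection onto a subspace containing \<open>\<eta>\<close>, so
  it brings \<open>y\<close> closer to \<open>\<eta>\<close>. The multiplier \<open>0\<close> vanishes off every set of arcs, however the
  active sets change; hence the iterates are bounded, have limit points, and have increments
  tending to zero.

  Vanishing increments let the optimality condition pass to the limit along any convergent
  subsequence, so a limit point minimises its Lagrangian in the primal variable
  (\<open>limit_point_minimises_lagrangian\<close>). They also force the disagreement over the active arcs to
  vanish; as there are only finitely many sets of arcs, one basic set among the active ones has zero
  disagreement at the limit, which is thus a consensus point (\<open>limit_point_consensus\<close>).
  Together these give saddle points.

  For convergence of the whole sequence, a limit point taken along the times at which the active set
  is \<open>I\<close> has a multiplier that vanishes off \<open>I\<close>, hence off every active set. So the Fejer estimate
  applies to this very limit point: the distance to it decreases, and tends to zero along a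
  subsequence.
\<close>

section \<open>Restriction of dual vectors and the stacked map\<close>

definition restrict_arcs :: "'l set \<Rightarrow> real^'n^'l::finite \<Rightarrow> real^'n^'l" where
  "restrict_arcs I y = (\<chi> i. if i \<in> I then y $ i else 0)"

lemma restrict_arcs_nth [simp]: "restrict_arcs I y $ i = (if i \<in> I then y $ i else 0)"
  by (simp add: restrict_arcs_def)

lemma linear_restrict_arcs: "linear (restrict_arcs I)"
  by (rule linearI) (auto simp: vec_eq_iff)

lemma inner_restrict_arcs: "restrict_arcs I a \<bullet> b = a \<bullet> restrict_arcs I b"
  unfolding inner_vec_def[where 'a = "real^'n"] by (intro sum.cong) auto

lemma restrict_arcs_idem [simp]: "restrict_arcs I (restrict_arcs I a) = restrict_arcs I a"
  by (auto simp: vec_eq_iff)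

lemma norm_restrict_arcs_le: "norm (restrict_arcs I a) \<le> norm a"
  unfolding norm_vec_def[where 'a = "real^'n"] by (intro L2_set_mono) auto

lemma stacked_map_eq_restrict: "stacked_map ends I x = restrict_arcs I (stacked_map ends UNIV x)"
  by (auto simp: stacked_map_def vec_eq_iff)

lemma linear_stacked_map: "linear (stacked_map ends I)"
  by (rule linearI) (auto simp: stacked_map_def arc_diff_def vec_eq_iff algebra_simps)

lemma basic_index_set_mono:
  fixes ends :: "'l::finite \<Rightarrow> 'm::finite \<times> 'm"
  assumes "basic_index_set TYPE('n::finite) ends I" "I \<subseteq> J"
  shows "basic_index_set TYPE('n) ends J"
  unfolding basic_index_set_def
proof (intro allI impI)
  fix v :: "real^'n^'m"
  assume "stacked_map ends J v = 0"
  moreover have "stacked_map ends I v = restrict_arcs I (stacked_map ends J v)"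
    using assms(2) by (subst vec_eq_iff) (auto simp: stacked_map_def)
  ultimately have "stacked_map ends I v = 0" by (simp add: linear_0[OF linear_restrict_arcs])
  then show "stacked_map ends UNIV v = 0" using assms(1) unfolding basic_index_set_def by blast
qed

lemma bounded_linear_stacked_map: "bounded_linear (stacked_map ends I)"
  using linear_stacked_map linear_conv_bounded_linear by blast

text \<open>
  The vectors \<open>v_s\<close> are the blocks of the adjoint of \<open>A\<close> applied to the predicted multiplier; this
  is why the updates of the agents together minimise a Lagrangian.
\<close>

lemma sum_pdmi_v_inner:
  "(\<Sum>s\<in>UNIV. pdmi_v ends I lam x y s \<bullet> u $ s) =
     restrict_arcs I (y + lam *\<^sub>R stacked_map ends UNIV x) \<bullet> stacked_map ends UNIV u"
proof -
  let ?p = "pdmi_p ends lam x y"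
  have by_ends: "(\<Sum>s\<in>UNIV. \<Sum>i\<in>{i \<in> I. g i = s}. ?p i \<bullet> u $ s) = (\<Sum>i\<in>I. ?p i \<bullet> u $ g i)" for g
  proof -
    have "(\<Sum>s\<in>UNIV. \<Sum>i\<in>{i \<in> I. g i = s}. ?p i \<bullet> u $ s)
        = (\<Sum>s\<in>UNIV. \<Sum>i\<in>{i \<in> I. g i = s}. ?p i \<bullet> u $ g i)"
      by (intro sum.cong) auto
    also have "\<dots> = (\<Sum>i\<in>I. ?p i \<bullet> u $ g i)"
      by (rule sum.group) auto
    finally show ?thesis .
  qed
  have "(\<Sum>s\<in>UNIV. pdmi_v ends I lam x y s \<bullet> u $ s)
      = (\<Sum>i\<in>I. ?p i \<bullet> u $ fst (ends i)) - (\<Sum>i\<in>I. ?p i \<bullet> u $ snd (ends i))"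
    unfolding pdmi_v_def arcs_out_def arcs_in_def
    by (simp add: inner_diff_left inner_sum_left sum_subtractf by_ends)
  also have "\<dots> = (\<Sum>i\<in>I. ?p i \<bullet> arc_diff ends i u)"
    by (simp add: arc_diff_def inner_diff_right sum_subtractf)
  also have "\<dots> = (\<Sum>i\<in>UNIV. if i \<in> I then ?p i \<bullet> arc_diff ends i u else 0)"
    by (simp add: sum.If_cases)
  also have "\<dots> = restrict_arcs I (y + lam *\<^sub>R stacked_map ends UNIV x) \<bullet> stacked_map ends UNIV u"
    unfolding inner_vec_def[where 'a = "real^'n"]
    by (intro sum.cong) (auto simp: stacked_map_def arc_diff_def pdmi_p_def)
  finally show ?thesis .
qed

section \<open>Saddle points\<close>

text \<open>
  The Lagrangian is affine in the multiplier, so it is bounded above in it only at consensus points,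
  where it does not depend on the multiplier at all.
\<close>

lemma saddle_points_iff:
  "(xs, ys) \<in> saddle_points f X ends \<longleftrightarrow>
     xs \<in> product_set X \<and> stacked_map ends UNIV xs = 0 \<and>
     (\<forall>u \<in> product_set X. total_cost f xs \<le> total_cost f u + ys \<bullet> stacked_map ends UNIV u)"
proof -
  have "(\<forall>y. lagrangian f ends xs y \<le> lagrangian f ends xs ys) \<longleftrightarrow> stacked_map ends UNIV xs = 0"
  proof
    assume "\<forall>y. lagrangian f ends xs y \<le> lagrangian f ends xs ys"
    then have "lagrangian f ends xs (ys + stacked_map ends UNIV xs) \<le> lagrangian f ends xs ys"
      by blast
    then have "stacked_map ends UNIV xs \<bullet> stacked_map ends UNIV xs \<le> 0"
      by (simp add: lagrangian_def inner_add_left)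
    then show "stacked_map ends UNIV xs = 0"
      by (metis inner_eq_zero_iff inner_ge_zero order_antisym)
  qed (simp add: lagrangian_def)
  then show ?thesis
    by (auto simp: saddle_points_def lagrangian_def)
qed

lemma unconstrained_consensus_solution_is_saddle:
  assumes "xs \<in> F_star f X" "xs \<in> consensus_set ends UNIV"
  shows "(xs, 0) \<in> saddle_points f X ends"
  using assms unfolding saddle_points_iff F_star_def solution_set_def consensus_set_def
  by (auto simp: is_arg_min_linorder)

section \<open>One step of the method\<close>

text \<open>
  Optimality of a proximal point, in a first-order form that needs no subgradients: compare it with
  the points of the segment towards \<open>u\<close>, divide by the length parameter \<open>t\<close>, and let \<open>t\<close> tend to
  zero.
\<close>

lemma proximal_point_variational_inequality:
  fixes \<phi> :: "'a::real_inner \<Rightarrow> real"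
  assumes "convex S" and cvx: "convex_on S \<phi>" and "lam > 0"
    and min: "is_arg_min (\<lambda>u. \<phi> u + 0.5 * inverse lam * (norm (u - c))\<^sup>2) (\<lambda>u. u \<in> S) z"
    and "u \<in> S"
  shows "\<phi> z \<le> \<phi> u + inverse lam * ((z - c) \<bullet> (u - z))"
proof -
  have z: "z \<in> S" using min by (simp add: is_arg_min_def)
  let ?R = "\<lambda>t. \<phi> u + inverse lam * ((z - c) \<bullet> (u - z)) + t * (0.5 * inverse lam * (norm (u - z))\<^sup>2)"
  have bound: "\<phi> z \<le> ?R t" if t: "0 < t" "t < 1" for t
  proof -
    define q where "q = (1 - t) *\<^sub>R z + t *\<^sub>R u"
    have "q \<in> S" unfolding q_def using \<open>convex S\<close> z \<open>u \<in> S\<close> t by (simp add: convexD)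
    then have "\<phi> z + 0.5 * inverse lam * (norm (z - c))\<^sup>2 \<le> \<phi> q + 0.5 * inverse lam * (norm (q - c))\<^sup>2"
      using min by (simp add: is_arg_min_linorder)
    moreover have "\<phi> q \<le> (1 - t) * \<phi> z + t * \<phi> u"
      unfolding q_def using convex_onD[OF cvx, of t z u] t z \<open>u \<in> S\<close> by simp
    moreover have "0.5 * inverse lam * (norm (q - c))\<^sup>2 = 0.5 * inverse lam * (norm (z - c))\<^sup>2
        + t * (inverse lam * ((z - c) \<bullet> (u - z))) + t * (t * (0.5 * inverse lam * (norm (u - z))\<^sup>2))"
    proof -
      have "(norm (q - c))\<^sup>2
        = (norm (z - c))\<^sup>2 + 2 * t * ((z - c) \<bullet> (u - z)) + t\<^sup>2 * (norm (u - z))\<^sup>2"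
      proof -
        have "q - c = (z - c) + t *\<^sub>R (u - z)" by (simp add: q_def algebra_simps)
        then show ?thesis
          by (simp only: power2_norm_eq_inner)
            (simp add: inner_add_left inner_add_right inner_commute power2_eq_square algebra_simps)
      qed
      then show ?thesis by (simp add: power2_eq_square distrib_left mult_ac)
    qed
    moreover have "(1 - t) * \<phi> z = \<phi> z - t * \<phi> z" by (simp add: left_diff_distrib)
    ultimately have "t * \<phi> z \<le> t * ?R t"
      by (simp only: distrib_left)
    then show ?thesis using t by simp
  qed
  have "(?R \<longlongrightarrow> ?R 0) (at_right 0)" by (intro tendsto_intros)
  moreover have "eventually (\<lambda>t. \<phi> z \<le> ?R t) (at_right (0::real))"
    unfolding eventually_at_right_field using bound by (intro exI[of _ 1]) auto
  ultimately have "\<phi> z \<le> ?R 0"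
    by (intro tendsto_lowerbound) auto
  then show ?thesis by simp
qed

text \<open>
  The assignment of zeros off \<open>I\<close> and the dual update on \<open>I\<close> are merged into one projection, the
  form in which both the adjoint identity and the Pythagorean identity apply.
\<close>

definition pdmi_step ::
  "('m::finite \<Rightarrow> real^'n \<Rightarrow> real) \<Rightarrow> ('m \<Rightarrow> (real^'n) set) \<Rightarrow> ('l::finite \<Rightarrow> 'm \<times> 'm) \<Rightarrow>
   'l set \<Rightarrow> real \<Rightarrow> real^'n^'m \<Rightarrow> real^'n^'l \<Rightarrow> real^'n^'m \<Rightarrow> real^'n^'l \<Rightarrow> bool" where
  "pdmi_step f X ends I lam x y x' y' \<longleftrightarrow>
     lam > 0 \<and>
     (\<forall>s. is_arg_min
            (\<lambda>u. f s u + pdmi_v ends I lam x y s \<bullet> u + 0.5 * inverse lam * (norm (u - x $ s))\<^sup>2)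
            (\<lambda>u. u \<in> X s) (x' $ s)) \<and>
     y' = restrict_arcs I (y + lam *\<^sub>R stacked_map ends UNIV x')"

lemma pdmi_sequence_step:
  assumes "pdmi_sequence f X ends Is lam x y"
  shows "pdmi_step f X ends (Is (Suc k)) (lam (Suc k)) (x k) (y k) (x (Suc k)) (y (Suc k))"
proof -
  have *: "Suc k \<ge> 1" by simp
  have "y (Suc k) $ i = restrict_arcs (Is (Suc k)) (y k + lam (Suc k) *\<^sub>R stacked_map ends UNIV (x (Suc k))) $ i" for i
    using assms * unfolding pdmi_sequence_def
    by (cases "i \<in> Is (Suc k)") (auto simp: stacked_map_def arc_diff_def)
  then have eq: "y (Suc k) = restrict_arcs (Is (Suc k)) (y k + lam (Suc k) *\<^sub>R stacked_map ends UNIV (x (Suc k)))"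
    by (simp only: vec_eq_iff[where 'a = "real^'n"]) blast
  show ?thesis
    unfolding pdmi_step_def
  proof (intro conjI)
    show "0 < lam (Suc k)"
      using assms * unfolding pdmi_sequence_def by blast
    have "\<forall>s. is_arg_min
        (\<lambda>u. f s u + pdmi_v ends (Is (Suc k)) (lam (Suc k)) (x (Suc k - 1)) (y (Suc k - 1)) s \<bullet> u
              + 0.5 * inverse (lam (Suc k)) * (norm (u - x (Suc k - 1) $ s))\<^sup>2)
        (\<lambda>u. u \<in> X s) (x (Suc k) $ s)"
      using assms * unfolding pdmi_sequence_def by blast
    then show "\<forall>s. is_arg_min
        (\<lambda>u. f s u + pdmi_v ends (Is (Suc k)) (lam (Suc k)) (x k) (y k) s \<bullet> u
              + 0.5 * inverse (lam (Suc k)) * (norm (u - x k $ s))\<^sup>2)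
        (\<lambda>u. u \<in> X s) (x (Suc k) $ s)"
      unfolding diff_Suc_1 .
  qed (rule eq)
qed

lemma pdmi_step_product_set:
  "pdmi_step f X ends I lam x y x' y' \<Longrightarrow> x' \<in> product_set X"
  by (simp add: pdmi_step_def product_set_def is_arg_min_def)

lemma pdmi_step_dual_support:
  "pdmi_step f X ends I lam x y x' y' \<Longrightarrow> restrict_arcs I y' = y'"
  by (simp add: pdmi_step_def)

lemma pdmi_step_dual_increment:
  assumes "pdmi_step f X ends I lam x y x' y'"
  shows "lam *\<^sub>R stacked_map ends I x' = y' - restrict_arcs I y"
  using assms unfolding pdmi_step_def stacked_map_eq_restrict[of ends I]
  by (simp add: linear_add[OF linear_restrict_arcs] linear_scale[OF linear_restrict_arcs])

text \<open>
  The prediction differs from the corrected multiplier by \<open>lam *\<^sub>R stacked_map ends I (x - x')\<close>, so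
  the primal update satisfies the optimality condition of the Lagrangian at \<open>y'\<close> up to an error
  controlled by the primal increment.
\<close>

lemma pdmi_step_variational_inequality:
  assumes step: "pdmi_step f X ends I lam x y x' y'"
    and cX: "\<And>j. convex (X j)" and cf: "\<And>j. convex_on UNIV (f j)"
    and u: "u \<in> product_set X"
  defines "p \<equiv> y' + lam *\<^sub>R stacked_map ends I (x - x')"
  shows "total_cost f x' + p \<bullet> stacked_map ends UNIV x'
       \<le> total_cost f u + p \<bullet> stacked_map ends UNIV u + inverse lam * ((x' - x) \<bullet> (u - x'))"
proof -
  let ?v = "pdmi_v ends I lam x y"
  have p: "p = restrict_arcs I (y + lam *\<^sub>R stacked_map ends UNIV x)"
    using step unfolding pdmi_step_def p_def stacked_map_eq_restrict[of ends I]
    by (simp add: linear_add[OF linear_restrict_arcs] linear_scale[OF linear_restrict_arcs]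
        linear_diff[OF linear_restrict_arcs] linear_diff[OF linear_stacked_map] algebra_simps)
  have blockwise: "f s (x' $ s) + ?v s \<bullet> x' $ s
      \<le> f s (u $ s) + ?v s \<bullet> u $ s + inverse lam * ((x' $ s - x $ s) \<bullet> (u $ s - x' $ s))" for s
  proof (rule proximal_point_variational_inequality[where S = "X s" and \<phi> = "\<lambda>u. f s u + ?v s \<bullet> u"])
    show "convex_on (X s) (\<lambda>u. f s u + ?v s \<bullet> u)"
    proof (rule convex_on_add)
      show "convex_on (X s) (f s)"
        using cf[of s] cX[of s] by (auto simp: convex_on_def)
      show "convex_on (X s) ((\<bullet>) (?v s))"
        using cX[of s] by (intro convex_onI) (auto simp: inner_add_right)
    qed
  qed (use step u cX in \<open>auto simp: pdmi_step_def product_set_def\<close>)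
  have "(\<Sum>s\<in>UNIV. f s (x' $ s) + ?v s \<bullet> x' $ s)
      \<le> (\<Sum>s\<in>UNIV. f s (u $ s) + ?v s \<bullet> u $ s + inverse lam * ((x' $ s - x $ s) \<bullet> (u $ s - x' $ s)))"
    by (intro sum_mono blockwise)
  then show ?thesis
    unfolding p
    by (simp add: sum.distrib sum_pdmi_v_inner total_cost_def inner_vec_def[of "x' - x"]
        flip: sum_distrib_left)
qed

text \<open>
  Minimality of \<open>xs\<close> for the Lagrangian with multiplier \<open>\<eta>\<close> cancels the cost terms of the primal optimality condition and
  replaces the prediction \<open>p\<close> by \<open>p - \<eta>\<close>; exchanging \<open>p\<close> for the corrected multiplier \<open>y'\<close> costs
  the cross term that \<open>\<kappa>\<close> bounds.
\<close>

lemma pdmi_step_Fejer: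
  fixes x x' xs :: "real^'n^'m::finite" and y y' \<eta> :: "real^'n^'l::finite"
  assumes step: "pdmi_step f X ends I lam x y x' y'"
    and cX: "\<And>j. convex (X j)" and cf: "\<And>j. convex_on UNIV (f j)"
    and \<kappa>: "lam * onorm (stacked_map ends I :: real^'n^'m \<Rightarrow> real^'n^'l) \<le> \<kappa>" "\<kappa> \<le> 1"
    and saddle: "(xs, \<eta>) \<in> saddle_points f X ends"
    and supp: "restrict_arcs I \<eta> = \<eta>"
  shows "(norm ((x', y') - (xs, \<eta>)))\<^sup>2 + (1 - \<kappa>) * (norm ((x', y') - (x, y)))\<^sup>2
       \<le> (norm ((x, y) - (xs, \<eta>)))\<^sup>2"
proof -
  let ?S = "stacked_map ends I :: real^'n^'m \<Rightarrow> real^'n^'l"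
  let ?A = "stacked_map ends UNIV :: real^'n^'m \<Rightarrow> real^'n^'l"
  define yt where "yt = restrict_arcs I y"
  have lam: "lam > 0" using step by (simp add: pdmi_step_def)
  have \<kappa>0: "0 \<le> \<kappa>"
    using \<kappa>(1) lam onorm_pos_le[OF bounded_linear_stacked_map[of ends I]]
    by (meson less_imp_le mult_nonneg_nonneg order_trans)
  have incr: "lam *\<^sub>R ?S x' = y' - yt"
    using pdmi_step_dual_increment[OF step] by (simp add: yt_def)
  have y': "restrict_arcs I y' = y'" using pdmi_step_dual_support[OF step] .
  have SA: "a \<bullet> ?A v = a \<bullet> ?S v" if "restrict_arcs I a = a" for a v
    using inner_restrict_arcs[of I a "?A v"] that by (simp add: stacked_map_eq_restrict[of ends I])
  have xs: "xs \<in> product_set X" "?A xs = 0"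
    and low: "total_cost f xs \<le> total_cost f x' + \<eta> \<bullet> ?S x'"
    using saddle pdmi_step_product_set[OF step] SA[OF supp] by (auto simp: saddle_points_iff)
  define p where "p = y' + lam *\<^sub>R ?S (x - x')"
  have p_supp: "restrict_arcs I p = p"
    unfolding p_def stacked_map_eq_restrict[of ends I] using y'
    by (simp add: linear_add[OF linear_restrict_arcs] linear_scale[OF linear_restrict_arcs])
  have primal: "total_cost f x' + p \<bullet> ?S x' \<le> total_cost f xs + inverse lam * ((x' - x) \<bullet> (xs - x'))"
    using pdmi_step_variational_inequality[OF step cX cf xs(1)] xs(2) SA[OF p_supp]
    by (simp add: p_def)
  have "p \<bullet> ?S x' - \<eta> \<bullet> ?S x' \<le> inverse lam * ((x' - x) \<bullet> (xs - x'))"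
    using primal low by linarith
  then have "lam * ((p - \<eta>) \<bullet> ?S x') \<le> (x' - x) \<bullet> (xs - x')"
    using lam by (simp add: inner_diff_left field_simps)
  moreover have "lam * ((p - \<eta>) \<bullet> ?S x') = (p - \<eta>) \<bullet> (y' - yt)"
    by (simp flip: incr)
  moreover have "(p - \<eta>) \<bullet> (y' - yt) = (y' - \<eta>) \<bullet> (y' - yt) - lam * (?S (x' - x) \<bullet> (y' - yt))"
    by (simp add: p_def linear_diff[OF linear_stacked_map] inner_add_left inner_diff_left algebra_simps)
  moreover have "lam * (?S (x' - x) \<bullet> (y' - yt)) \<le> \<kappa> * (norm (x' - x) * norm (y' - yt))"
  proof -
    have "?S (x' - x) \<bullet> (y' - yt) \<le> norm (?S (x' - x)) * norm (y' - yt)"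
      by (rule norm_cauchy_schwarz)
    also have "\<dots> \<le> (onorm ?S * norm (x' - x)) * norm (y' - yt)"
      by (intro mult_right_mono onorm bounded_linear_stacked_map) auto
    finally have "lam * (?S (x' - x) \<bullet> (y' - yt)) \<le> (lam * onorm ?S) * (norm (x' - x) * norm (y' - yt))"
      using lam by (simp add: mult_ac)
    also have "\<dots> \<le> \<kappa> * (norm (x' - x) * norm (y' - yt))"
      using \<kappa>(1) by (intro mult_right_mono) auto
    finally show ?thesis .
  qed
  ultimately have cross: "(y' - \<eta>) \<bullet> (y' - yt)
      \<le> (x' - x) \<bullet> (xs - x') + \<kappa> * (norm (x' - x) * norm (y' - yt))"
    by linarith
  have "2 * (norm (x' - x) * norm (y' - yt)) \<le> (norm (x' - x))\<^sup>2 + (norm (y' - yt))\<^sup>2"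
    using sum_squares_bound[of "norm (x' - x)" "norm (y' - yt)"] by (simp add: mult_ac)
  then have "2 * (\<kappa> * (norm (x' - x) * norm (y' - yt))) \<le> \<kappa> * ((norm (x' - x))\<^sup>2 + (norm (y' - yt))\<^sup>2)"
    using mult_left_mono[OF _ \<kappa>0] by fastforce
  moreover have "2 * ((x' - x) \<bullet> (xs - x')) = (norm (x - xs))\<^sup>2 - (norm (x' - x))\<^sup>2 - (norm (x' - xs))\<^sup>2"
    unfolding power2_norm_eq_inner by (simp add: inner_diff_left inner_diff_right inner_commute)
  moreover have "2 * ((y' - \<eta>) \<bullet> (y' - yt)) = (norm (y' - \<eta>))\<^sup>2 + (norm (y' - yt))\<^sup>2 - (norm (yt - \<eta>))\<^sup>2"
    unfolding power2_norm_eq_inner by (simp add: inner_diff_left inner_diff_right inner_commute)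
  \<comment> \<open>Erasing the inactive components is an orthogonal projection, and \<open>y'\<close>, \<open>\<eta>\<close> lie in its range.\<close>
  moreover have pyth: "(norm (y - b))\<^sup>2 = (norm (yt - b))\<^sup>2 + (norm (y - yt))\<^sup>2"
    if "restrict_arcs I b = b" for b
  proof -
    have "(yt - b) \<bullet> (y - yt) = restrict_arcs I (yt - b) \<bullet> (y - yt)"
      using that by (simp add: yt_def linear_diff[OF linear_restrict_arcs])
    also have "\<dots> = 0"
      unfolding inner_restrict_arcs by (simp add: yt_def linear_diff[OF linear_restrict_arcs])
    finally have "(yt - b) \<bullet> (y - yt) = 0" .
    moreover have "y - b = (yt - b) + (y - yt)" by simp
    ultimately show ?thesis
      using norm_add_Pythagorean[of "yt - b" "y - yt"] by (simp add: orthogonal_def)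
  qed
  moreover have "(1 - \<kappa>) * (norm (y - yt))\<^sup>2 \<le> (norm (y - yt))\<^sup>2"
    using \<kappa>0 by (simp add: mult_left_le_one_le \<kappa>(2))
  moreover note pyth[OF supp] pyth[OF y'] cross
  ultimately have "(norm (x' - xs))\<^sup>2 + (norm (y' - \<eta>))\<^sup>2
      + (1 - \<kappa>) * ((norm (x' - x))\<^sup>2 + (norm (y' - y))\<^sup>2) \<le> (norm (x - xs))\<^sup>2 + (norm (y - \<eta>))\<^sup>2"
    by (simp add: algebra_simps norm_minus_commute)
  then show ?thesis by (simp add: norm_Pair)
qed

section \<open>Sequences with a Fejer estimate\<close>

lemma Fejer_decseq:
  fixes w :: "nat \<Rightarrow> 'a::real_normed_vector"
  assumes "c \<ge> 0" "\<And>k. (norm (w (Suc k) - z))\<^sup>2 + c * (norm (w (Suc k) - w k))\<^sup>2 \<le> (norm (w k - z))\<^sup>2"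
  shows "decseq (\<lambda>k. norm (w k - z))"
proof (rule decseq_SucI)
  fix k
  have "0 \<le> c * (norm (w (Suc k) - w k))\<^sup>2" using \<open>c \<ge> 0\<close> by simp
  then have "(norm (w (Suc k) - z))\<^sup>2 \<le> (norm (w k - z))\<^sup>2" using assms(2)[of k] by linarith
  then show "norm (w (Suc k) - z) \<le> norm (w k - z)" by (rule power2_le_imp_le) simp
qed

lemma Fejer_bounded:
  fixes w :: "nat \<Rightarrow> 'a::real_normed_vector"
  assumes "c \<ge> 0" "\<And>k. (norm (w (Suc k) - z))\<^sup>2 + c * (norm (w (Suc k) - w k))\<^sup>2 \<le> (norm (w k - z))\<^sup>2"
  shows "bounded (range w)"
proof -
  have "w k \<in> cball z (norm (w 0 - z))" for k
    using decseqD[OF Fejer_decseq[of c w z], of 0 k] assms by (simp add: dist_norm norm_minus_commute)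
  then show ?thesis by (intro bounded_subset[OF bounded_cball]) auto
qed

text \<open>The squared increments are dominated by the differences of a convergent sequence.\<close>

lemma Fejer_increments_null:
  fixes w :: "nat \<Rightarrow> 'a::real_normed_vector"
  assumes c: "c > 0"
    and F: "\<And>k. (norm (w (Suc k) - z))\<^sup>2 + c * (norm (w (Suc k) - w k))\<^sup>2 \<le> (norm (w k - z))\<^sup>2"
  shows "(\<lambda>k. w (Suc k) - w k) \<longlonglongrightarrow> 0"
proof -
  have "decseq (\<lambda>k. norm (w k - z))" using F c by (intro Fejer_decseq[where c = c]) auto
  then obtain L where L: "(\<lambda>k. norm (w k - z)) \<longlonglongrightarrow> L"
    by (rule decseq_convergent[where B = 0]) auto
  let ?g = "\<lambda>k. ((norm (w k - z))\<^sup>2 - (norm (w (Suc k) - z))\<^sup>2) / c"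
  have "?g \<longlonglongrightarrow> (L\<^sup>2 - L\<^sup>2) / c"
    using c by (intro tendsto_intros L LIMSEQ_Suc[OF L]) auto
  then have "?g \<longlonglongrightarrow> 0" by simp
  then have "(\<lambda>k. (norm (w (Suc k) - w k))\<^sup>2) \<longlonglongrightarrow> 0"
  proof (rule tendsto_sandwich[rotated -1])
    have "(norm (w (Suc k) - w k))\<^sup>2 \<le> ?g k" for k
      using F[of k] c by (simp add: field_simps)
    then show "\<forall>\<^sub>F k in sequentially. (norm (w (Suc k) - w k))\<^sup>2 \<le> ?g k" by simp
  qed auto
  then have "(\<lambda>k. sqrt ((norm (w (Suc k) - w k))\<^sup>2)) \<longlonglongrightarrow> sqrt 0" by (rule tendsto_real_sqrt)
  then show ?thesis by (simp add: tendsto_norm_zero_iff)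
qed

lemma decseq_norm_subsequence_imp_tendsto:
  fixes w :: "nat \<Rightarrow> 'a::real_normed_vector"
  assumes dec: "decseq (\<lambda>k. norm (w k - z))" and r: "strict_mono r" "(w \<circ> r) \<longlonglongrightarrow> z"
  shows "w \<longlonglongrightarrow> z"
proof -
  obtain L where L: "(\<lambda>k. norm (w k - z)) \<longlonglongrightarrow> L"
    by (rule decseq_convergent[OF dec, where B = 0]) auto
  have "((\<lambda>k. norm (w k - z)) \<circ> r) \<longlonglongrightarrow> L" using L r(1) by (rule LIMSEQ_subseq_LIMSEQ)
  moreover have "((\<lambda>k. norm (w k - z)) \<circ> r) \<longlonglongrightarrow> 0"
    using tendsto_norm[OF tendsto_diff[OF r(2) tendsto_const[of z]]] by (simp add: o_def)
  ultimately have "L = 0" by (rule LIMSEQ_unique)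
  then show ?thesis using L LIM_zero_iff tendsto_norm_zero_iff by blast
qed

section \<open>Limit points of the iterates\<close>

text \<open>
  The constant \<open>\<kappa>\<close> is the only trace of the upper stepsize bound: it controls both the cross term of
  the Fejer estimate and the gap between predicted and corrected multipliers. The lower bound
  \<open>\<tau>\<close> turns small increments into small residuals.
\<close>

locale pdmi_run =
  fixes ends :: "'l::finite \<Rightarrow> 'm::finite \<times> 'm"
    and f :: "'m \<Rightarrow> real^'n::finite \<Rightarrow> real"
    and X :: "'m \<Rightarrow> (real^'n) set"
    and Is :: "nat \<Rightarrow> 'l set"
    and lam :: "nat \<Rightarrow> real"
    and \<tau> \<kappa> :: real
    and x :: "nat \<Rightarrow> real^'n^'m"
    and y :: "nat \<Rightarrow> real^'n^'l"
  assumes convex_X: "\<And>j. convex (X j)"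
    and closed_X: "\<And>j. closed (X j)"
    and convex_f: "\<And>j. convex_on UNIV (f j)"
    and consensus_solution: "F_star f X \<inter> consensus_set ends UNIV \<noteq> {}"
    and step: "\<And>k. pdmi_step f X ends (Is (Suc k)) (lam (Suc k)) (x k) (y k) (x (Suc k)) (y (Suc k))"
    and \<tau>: "0 < \<tau>" "\<And>k. \<tau> \<le> lam (Suc k)"
    and \<kappa>: "\<And>k. lam (Suc k) * onorm (stacked_map ends (Is (Suc k)) :: real^'n^'m \<Rightarrow> real^'n^'l) \<le> \<kappa>"
           "\<kappa> < 1"
begin

abbreviation w :: "nat \<Rightarrow> (real^'n^'m) \<times> (real^'n^'l)" where
  "w k \<equiv> (x k, y k)"

lemma Fejer:
  assumes "(xs, \<eta>) \<in> saddle_points f X ends" "\<And>k. restrict_arcs (Is (Suc k)) \<eta> = \<eta>"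
  shows "(norm (w (Suc k) - (xs, \<eta>)))\<^sup>2 + (1 - \<kappa>) * (norm (w (Suc k) - w k))\<^sup>2 \<le> (norm (w k - (xs, \<eta>)))\<^sup>2"
  using \<kappa>(2) by (intro pdmi_step_Fejer[OF step convex_X convex_f \<kappa>(1) _ assms]) auto

lemma bounded_iterates: "bounded (range w)"
  and increments_null: "(\<lambda>k. w (Suc k) - w k) \<longlonglongrightarrow> 0"
proof -
  obtain xs where "xs \<in> F_star f X" "xs \<in> consensus_set ends UNIV"
    using consensus_solution by blast
  then have "(xs, 0) \<in> saddle_points f X ends"
    by (rule unconstrained_consensus_solution_is_saddle)
  then have F: "(norm (w (Suc k) - (xs, 0)))\<^sup>2 + (1 - \<kappa>) * (norm (w (Suc k) - w k))\<^sup>2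
      \<le> (norm (w k - (xs, 0)))\<^sup>2" for k
    by (rule Fejer) (auto simp: linear_0[OF linear_restrict_arcs])
  show "bounded (range w)" by (rule Fejer_bounded[where w = w and z = "(xs, 0)" and c = "1 - \<kappa>"]) (use \<kappa>(2) F in auto)
  show "(\<lambda>k. w (Suc k) - w k) \<longlonglongrightarrow> 0" by (rule Fejer_increments_null[where w = w and z = "(xs, 0)" and c = "1 - \<kappa>"]) (use \<kappa>(2) F in auto)
qed

lemma primal_increments_null: "(\<lambda>k. x (Suc k) - x k) \<longlonglongrightarrow> 0"
  and dual_increments_null: "(\<lambda>k. y (Suc k) - y k) \<longlonglongrightarrow> 0"
  using tendsto_fst[OF increments_null] tendsto_snd[OF increments_null] by simp_all

lemma null_subsequence:
  assumes "filterlim q sequentially sequentially" "g \<longlonglongrightarrow> (0::'a::real_normed_vector)"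
  shows "(\<lambda>j. g (q j)) \<longlonglongrightarrow> 0"
  using filterlim_compose[OF assms(2,1)] .

lemma limit_point_feasible:
  assumes "(\<lambda>j. x (Suc (q j))) \<longlonglongrightarrow> xb"
  shows "xb \<in> product_set X"
proof -
  have "xb $ s \<in> X s" for s
  proof (rule closed_sequentially[OF closed_X])
    show "\<And>j. x (Suc (q j)) $ s \<in> X s"
      using pdmi_step_product_set[OF step] by (simp add: product_set_def)
    show "(\<lambda>j. x (Suc (q j)) $ s) \<longlonglongrightarrow> xb $ s" using assms by (rule tendsto_vec_nth)
  qed
  then show ?thesis by (simp add: product_set_def)
qed

lemma limit_point_minimises_lagrangian:
  assumes q: "filterlim q sequentially sequentially"
    and xb: "(\<lambda>j. x (Suc (q j))) \<longlonglongrightarrow> xb" and yb: "(\<lambda>j. y (Suc (q j))) \<longlonglongrightarrow> yb"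
    and u: "u \<in> product_set X"
  shows "lagrangian f ends xb yb \<le> lagrangian f ends u yb"
proof -
  define d where "d k = lam (Suc k) *\<^sub>R stacked_map ends (Is (Suc k)) (x k - x (Suc k))" for k
  define h where "h k = inverse (lam (Suc k)) *\<^sub>R (x (Suc k) - x k)" for k
  have lam0: "0 < lam (Suc k)" for k using \<tau>(1) \<tau>(2)[of k] by linarith
  have "norm (d k) \<le> norm (x (Suc k) - x k) * \<kappa>" for k
  proof -
    let ?S = "stacked_map ends (Is (Suc k)) :: real^'n^'m \<Rightarrow> real^'n^'l"
    have "norm (d k) \<le> lam (Suc k) * (onorm ?S * norm (x k - x (Suc k)))"
      unfolding d_def using lam0[of k] onorm[OF bounded_linear_stacked_map] by simp
    also have "\<dots> = (lam (Suc k) * onorm ?S) * norm (x (Suc k) - x k)"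
      by (simp add: norm_minus_commute)
    also have "\<dots> \<le> \<kappa> * norm (x (Suc k) - x k)"
      using \<kappa>(1) by (intro mult_right_mono) auto
    finally show ?thesis by (simp add: mult.commute)
  qed
  then have d: "d \<longlonglongrightarrow> 0"
    by (intro tendsto_0_le[OF primal_increments_null, where K = "\<kappa>"] always_eventually) auto
  have "norm (h k) \<le> norm (x (Suc k) - x k) * inverse \<tau>" for k
  proof -
    have "inverse (lam (Suc k)) \<le> inverse \<tau>" using \<tau> by (intro le_imp_inverse_le) auto
    then show ?thesis
      unfolding h_def using lam0[of k] mult_left_mono[of _ _ "norm (x (Suc k) - x k)"]
      by (simp add: mult.commute)
  qed
  then have h: "h \<longlonglongrightarrow> 0"
    by (intro tendsto_0_le[OF primal_increments_null, where K = "inverse \<tau>"] always_eventually) auto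
  have cont: "continuous_on UNIV (total_cost f)"
    unfolding total_cost_def
    by (intro continuous_on_sum continuous_on_compose2[OF convex_on_continuous[OF open_UNIV convex_f]]
        continuous_intros) auto
  have A: "(\<lambda>j. stacked_map ends UNIV (x (Suc (q j)))) \<longlonglongrightarrow> stacked_map ends UNIV xb"
    by (rule bounded_linear.tendsto[OF bounded_linear_stacked_map xb])
  have fx: "(\<lambda>j. total_cost f (x (Suc (q j)))) \<longlonglongrightarrow> total_cost f xb"
    using continuous_on_tendsto_compose[OF cont xb] by simp
  let ?p = "\<lambda>j. y (Suc (q j)) + d (q j)"
  let ?L = "\<lambda>j. total_cost f (x (Suc (q j))) + ?p j \<bullet> stacked_map ends UNIV (x (Suc (q j)))"
  let ?R = "\<lambda>j. total_cost f u + ?p j \<bullet> stacked_map ends UNIV u + h (q j) \<bullet> (u - x (Suc (q j)))"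
  have "?L \<longlonglongrightarrow> total_cost f xb + (yb + 0) \<bullet> stacked_map ends UNIV xb"
    by (intro tendsto_intros fx yb A null_subsequence[OF q d])
  moreover have "?R \<longlonglongrightarrow> total_cost f u + (yb + 0) \<bullet> stacked_map ends UNIV u + 0 \<bullet> (u - xb)"
    by (intro tendsto_intros yb xb null_subsequence[OF q d] null_subsequence[OF q h])
  moreover have "?L j \<le> ?R j" for j
    using pdmi_step_variational_inequality[OF step convex_X convex_f u]
    by (simp add: d_def h_def)
  ultimately have "total_cost f xb + (yb + 0) \<bullet> stacked_map ends UNIV xb
      \<le> total_cost f u + (yb + 0) \<bullet> stacked_map ends UNIV u + 0 \<bullet> (u - xb)"
    by (intro LIMSEQ_le) auto
  then show ?thesis by (simp add: lagrangian_def)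
qed

lemma limit_point_consensus:
  assumes q: "filterlim q sequentially sequentially"
    and xb: "(\<lambda>j. x (Suc (q j))) \<longlonglongrightarrow> xb"
    and basic: "\<And>k. basic_index_set TYPE('n) ends (Is (Suc k))"
  shows "stacked_map ends UNIV xb = 0"
proof -
  let ?S = "\<lambda>k. stacked_map ends (Is (Suc k)) :: real^'n^'m \<Rightarrow> real^'n^'l"
  have "norm (?S k (x (Suc k))) \<le> norm (y (Suc k) - y k) * inverse \<tau>" for k
  proof -
    have lam0: "0 < lam (Suc k)" using \<tau>(1) \<tau>(2)[of k] by linarith
    have "lam (Suc k) *\<^sub>R ?S k (x (Suc k)) = restrict_arcs (Is (Suc k)) (y (Suc k) - y k)"
      using pdmi_step_dual_increment[OF step[of k]] pdmi_step_dual_support[OF step[of k]]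
      by (simp add: linear_diff[OF linear_restrict_arcs])
    then have "lam (Suc k) * norm (?S k (x (Suc k))) \<le> norm (y (Suc k) - y k)"
      using norm_restrict_arcs_le[of "Is (Suc k)" "y (Suc k) - y k"] lam0
      by (metis abs_of_pos norm_scaleR)
    moreover have "\<tau> * norm (?S k (x (Suc k))) \<le> lam (Suc k) * norm (?S k (x (Suc k)))"
      using \<tau>(2) by (intro mult_right_mono) auto
    ultimately show ?thesis using \<tau>(1) by (simp add: field_simps)
  qed
  then have active: "(\<lambda>k. ?S k (x (Suc k))) \<longlonglongrightarrow> 0"
    by (intro tendsto_0_le[OF dual_increments_null, where K = "inverse \<tau>"] always_eventually) auto
  have "(\<lambda>j. stacked_map ends UNIV (xb - x (Suc (q j)))) \<longlonglongrightarrow> stacked_map ends UNIV (xb - xb)"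
    by (intro bounded_linear.tendsto[OF bounded_linear_stacked_map] tendsto_intros xb)
  then have "(\<lambda>j. stacked_map ends UNIV (xb - x (Suc (q j)))) \<longlonglongrightarrow> 0"
    by (simp add: linear_0[OF linear_stacked_map])
  moreover have "norm (?S k v) \<le> norm (stacked_map ends UNIV v) * 1" for k and v :: "real^'n^'m"
    by (subst stacked_map_eq_restrict) (simp add: norm_restrict_arcs_le)
  ultimately have diff: "(\<lambda>j. ?S (q j) (xb - x (Suc (q j)))) \<longlonglongrightarrow> 0"
    by (rule tendsto_0_le[where K = 1, OF _ always_eventually[OF allI]])
  have lim: "(\<lambda>j. ?S (q j) xb) \<longlonglongrightarrow> 0"
    using tendsto_add[OF null_subsequence[OF q active] diff]
    by (simp add: linear_diff[OF linear_stacked_map])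
  \<comment> \<open>This sequence takes finitely many values, so its limit is one of them.\<close>
  have "range (\<lambda>j. ?S (q j) xb) \<subseteq> (\<lambda>I. stacked_map ends I xb) ` UNIV" by auto
  then have "finite (range (\<lambda>j. ?S (q j) xb))" by (rule finite_subset) simp
  then have "closed (range (\<lambda>j. ?S (q j) xb))" by (rule finite_imp_closed)
  then have "0 \<in> range (\<lambda>j. ?S (q j) xb)"
    by (rule closed_sequentially[OF _ _ lim]) auto
  then obtain j where "?S (q j) xb = 0" by auto
  then show ?thesis
    using basic[of "q j"] unfolding basic_index_set_def by blast
qed

lemma limit_point_saddle:
  assumes basic: "\<And>k. basic_index_set TYPE('n) ends (Is (Suc k))"
    and r: "strict_mono r" "(w \<circ> r) \<longlonglongrightarrow> (xb, yb)"
  shows "(xb, yb) \<in> saddle_points f X ends"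
proof -
  \<comment> \<open>Only iterates of positive index are produced by a step; \<open>r (Suc j)\<close> is positive.\<close>
  define q where "q j = r (Suc j) - 1" for j
  have pos: "Suc (q j) = r (Suc j)" for j
    using strict_monoD[OF r(1), of 0 "Suc j"] by (simp add: q_def)
  have "strict_mono q"
    using strict_monoD[OF r(1), of "Suc _" "Suc _"] pos by (intro strict_monoI) (metis Suc_less_eq)
  then have q: "filterlim q sequentially sequentially" by (rule filterlim_subseq)
  have "(\<lambda>j. w (Suc (q j))) \<longlonglongrightarrow> (xb, yb)"
    using LIMSEQ_Suc[OF r(2)] by (simp add: pos o_def)
  then have lim: "(\<lambda>j. x (Suc (q j))) \<longlonglongrightarrow> xb" "(\<lambda>j. y (Suc (q j))) \<longlonglongrightarrow> yb"
    using tendsto_fst tendsto_snd by fastforce+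
  show ?thesis
    using limit_point_feasible[OF lim(1)] limit_point_consensus[OF q lim(1) basic]
      limit_point_minimises_lagrangian[OF q lim]
    by (simp add: saddle_points_iff lagrangian_def)
qed

text \<open>
  Passing to times with active set \<open>I\<close> before extracting a limit point makes its multiplier supported
  on \<open>I\<close>, hence fixed by every later projection.
\<close>

lemma iterates_converge:
  fixes r :: "nat \<Rightarrow> nat"
  assumes I: "basic_index_set TYPE('n) ends I" "\<And>k. I \<subseteq> Is (Suc k)"
    and r: "strict_mono r" "\<And>j. Is (r j) = I"
  shows "\<exists>z \<in> saddle_points f X ends. w \<longlonglongrightarrow> z"
proof -
  have basic: "basic_index_set TYPE('n) ends (Is (Suc k))" for k
    by (rule basic_index_set_mono[OF I])
  have "bounded (range (w \<circ> r))"
    using bounded_iterates by (rule bounded_subset) auto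
  then obtain z r' where "strict_mono r'" "((w \<circ> r) \<circ> r') \<longlonglongrightarrow> z"
    using bounded_imp_convergent_subsequence[of "w \<circ> r"] by blast
  moreover obtain xb yb where "z = (xb, yb)" by (cases z)
  ultimately have r': "strict_mono r'" "((w \<circ> r) \<circ> r') \<longlonglongrightarrow> (xb, yb)" by auto
  define r2 where "r2 = r \<circ> r'"
  have r2: "strict_mono r2" "(w \<circ> r2) \<longlonglongrightarrow> (xb, yb)"
    using strict_mono_o[OF r(1) r'(1)] r'(2) by (simp_all only: r2_def o_assoc)
  have saddle: "(xb, yb) \<in> saddle_points f X ends"
    by (rule limit_point_saddle[OF basic r2])
  have off: "yb $ i = 0" if "i \<notin> I" for i
  proof -
    have "(\<lambda>j. y (r2 (Suc j)) $ i) \<longlonglongrightarrow> yb $ i"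
      using LIMSEQ_Suc[OF tendsto_vec_nth[OF tendsto_snd[OF r2(2)]], of i] by simp
    moreover have "y (r2 (Suc j)) $ i = 0" for j
    proof -
      obtain k where k: "r2 (Suc j) = Suc k"
        using strict_monoD[OF r2(1), of 0 "Suc j"] by (metis gr0_conv_Suc gr_zeroI not_less_zero zero_less_Suc)
      then have "Is (Suc k) = I" using r(2) by (metis comp_apply r2_def)
      then show ?thesis
        using pdmi_step_dual_support[OF step[of k]] that k by (metis restrict_arcs_nth)
    qed
    ultimately have "(\<lambda>j. 0) \<longlonglongrightarrow> yb $ i" by simp
    then show ?thesis by (simp add: LIMSEQ_const_iff)
  qed
  then have "restrict_arcs (Is (Suc k)) yb = yb" for k
    using I(2)[of k] by (subst vec_eq_iff) auto
  then have "decseq (\<lambda>k. norm (w k - (xb, yb)))"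
    using \<kappa>(2) Fejer[OF saddle]
    by (intro Fejer_decseq[where w = w and z = "(xb, yb)" and c = "1 - \<kappa>"]) auto
  then have "w \<longlonglongrightarrow> (xb, yb)"
    using r2 by (rule decseq_norm_subsequence_imp_tendsto)
  then show ?thesis using saddle by blast
qed

end

theorem corollary3:
  fixes ends :: "'l::finite \<Rightarrow> 'm::finite \<times> 'm"
    and f :: "'m \<Rightarrow> real^'n::finite \<Rightarrow> real"
    and X :: "'m \<Rightarrow> (real^'n) set"
    and Is :: "nat \<Rightarrow> 'l set"
    and lam :: "nat \<Rightarrow> real"
    and \<tau> :: real
    and x :: "nat \<Rightarrow> real^'n^'m"
    and y :: "nat \<Rightarrow> real^'n^'l"
  assumes "CARD('m) \<ge> 2"
    and "complete_orientation ends"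
    and "\<And>j. convex (X j)"
    and "\<And>j. closed (X j)"
    and "\<And>j. convex_on UNIV (f j)"
    and "D_star f X ends UNIV \<noteq> {}"
    and "F_star f X \<inter> consensus_set ends UNIV \<noteq> {}"
    and "pdmi_sequence f X ends Is lam x y"
    and "0 < \<tau>" and "\<tau> < 1"
    and "\<And>k. k \<ge> 1 \<Longrightarrow> \<tau> \<le> lam k"
    and "\<And>k. k \<ge> 1 \<Longrightarrow>
           onorm (stacked_map ends (Is k) :: real^'n^'m \<Rightarrow> real^'n^'l) \<noteq> 0 \<Longrightarrow>
           lam k \<le> sqrt (1 - \<tau>) /
             (sqrt 2 * onorm (stacked_map ends (Is k) :: real^'n^'m \<Rightarrow> real^'n^'l))"
  shows "(\<exists>z. seq_limit_point (\<lambda>k. (x k, y k)) z) \<and>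
    ((\<forall>k\<ge>1. basic_index_set TYPE('n) ends (Is k)) \<longrightarrow>
       (\<forall>z. seq_limit_point (\<lambda>k. (x k, y k)) z \<longrightarrow> z \<in> saddle_points f X ends)) \<and>
    ((\<exists>I. I \<noteq> {} \<and> basic_index_set TYPE('n) ends I \<and> (\<forall>k\<ge>1. I \<subseteq> Is k) \<and>
          (\<exists>r :: nat \<Rightarrow> nat. strict_mono r \<and> (\<forall>j. Is (r j) = I))) \<longrightarrow>
       (\<exists>z \<in> saddle_points f X ends. (\<lambda>k. (x k, y k)) \<longlonglongrightarrow> z))"
proof -
  \<comment> \<open>The stepsize bound is \<open>lam k * onorm A_k \<le> \<kappa>\<close>, read as trivial when the norm vanishes.\<close>
  define \<kappa> where "\<kappa> = sqrt ((1 - \<tau>) / 2)"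
  have \<kappa>0: "0 \<le> \<kappa>" using assms(10) by (simp add: \<kappa>_def)
  have bound: "lam (Suc k) * onorm (stacked_map ends (Is (Suc k)) :: real^'n^'m \<Rightarrow> real^'n^'l) \<le> \<kappa>" for k
  proof (cases "onorm (stacked_map ends (Is (Suc k)) :: real^'n^'m \<Rightarrow> real^'n^'l) = 0")
    case True
    then show ?thesis using \<kappa>0 by simp
  next
    case False
    let ?N = "onorm (stacked_map ends (Is (Suc k)) :: real^'n^'m \<Rightarrow> real^'n^'l)"
    have "0 < ?N"
      using False onorm_pos_le[OF bounded_linear_stacked_map] order_le_less by metis
    then show ?thesis
      using assms(12)[of "Suc k"] by (simp add: \<kappa>_def real_sqrt_divide field_simps)
  qed
  interpret pdmi_run ends f X Is lam \<tau> \<kappa> x y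
  proof
    show "\<kappa> < 1" using assms(9) by (simp add: \<kappa>_def)
  qed (use assms(3-5,7,9,11) bound pdmi_sequence_step[OF assms(8)] in auto)
  have "\<exists>z. seq_limit_point w z"
    using bounded_imp_convergent_subsequence[OF bounded_iterates]
    unfolding seq_limit_point_def by blast
  moreover have "z \<in> saddle_points f X ends"
    if "\<forall>k\<ge>1. basic_index_set TYPE('n) ends (Is k)" "seq_limit_point w z" for z
    using that limit_point_saddle unfolding seq_limit_point_def by (cases z) auto
  moreover have "\<exists>z \<in> saddle_points f X ends. w \<longlonglongrightarrow> z"
    if "basic_index_set TYPE('n) ends I" "\<forall>k\<ge>1. I \<subseteq> Is k" "strict_mono r" "\<forall>j. Is (r j) = I"
    for I and r :: "nat \<Rightarrow> nat"
    using that by (intro iterates_converge[of I r]) auto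
  ultimately show ?thesis by blast
qed

end
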